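(* Let $X_t$ be a BN random process, with $X_t\sim\text{BN}(\boldsymbol{\theta}_t)$, $\boldsymbol{\theta}_t=(\mu_t,\sigma_t,\alpha)$. If $\mu_t$ and $\sigma_t$ are not independent of time (i.e. they are not constant in $t$), then $X_t$ is not weak-sense stationary.
   Context: For $\mu\in\mathbb{R}$, $\sigma>0$, $\alpha\in\mathbb{R}$, BN$(\mu,\sigma,\alpha)$ is the distribution on $\mathbb{R}$ with PDF $$f(x;\mu,\sigma,\alpha)=\frac{1}{\sqrt{2\pi\sigma^2}}\exp\left[-\frac12\left(\frac{x-\mu}{\sigma}\right)^2-\frac{\alpha^2}{2}\right]\cosh\left[\alpha\left(\frac{x-\mu}{\sigma}\right)\right].$$ A process $X_t$ ($t\in\mathbb{R}$) is a BN random process if $X_t\sim\text{BN}(\boldsymbol{\theta}_t)$ for every $t$, where $\boldsymbol{\theta}_t=(\mu_t,\sigma_t,\alpha)$, $\mu_t\in\mathbb{R}$, $\sigma_t>0$, $\alpha\in\mathbb{R}$ ($\alpha$ does not depend on $t$). A process $X_t$ is weak-sense stationary (WSS) if: $\mathbb{E}(X_t)=\mu$ is independent of time; $\mathbb{E}(X_t^2)<\infty$; and $C_X(t,s)=\mathrm{Cov}(X_t,X_s)$ depends only on the distance between the times $t$ and $s$. *)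

theory Defs
  imports "HOL-Probability.Probability"
begin

definition bn_density :: "real \<Rightarrow> real \<Rightarrow> real \<Rightarrow> real \<Rightarrow> real" where
  "bn_density \<mu> \<sigma> \<alpha> x =
     1 / sqrt (2 * pi * \<sigma>\<^sup>2) * exp (- (1 / 2) * ((x - \<mu>) / \<sigma>)\<^sup>2 - \<alpha>\<^sup>2 / 2)
       * cosh (\<alpha> * ((x - \<mu>) / \<sigma>))"

context prob_space
begin

definition bn_process ::
  "(real \<Rightarrow> 'a \<Rightarrow> real) \<Rightarrow> (real \<Rightarrow> real) \<Rightarrow> (real \<Rightarrow> real) \<Rightarrow> real \<Rightarrow> bool" where
  "bn_process X \<mu> \<sigma> \<alpha> \<longleftrightarrow>
     (\<forall>t. \<sigma> t > 0 \<and> distributed M lborel (X t) (\<lambda>x. ennreal (bn_density (\<mu> t) (\<sigma> t) \<alpha> x)))"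

definition covariance :: "('a \<Rightarrow> real) \<Rightarrow> ('a \<Rightarrow> real) \<Rightarrow> real" where
  "covariance X Y = expectation (\<lambda>\<omega>. (X \<omega> - expectation X) * (Y \<omega> - expectation Y))"

(* Finiteness of the second moment is integrability of the square: the Bochner integral of a
   non-integrable function is 0 by convention.  Together with measurability it makes the mean
   and the covariances well defined. *)
definition weak_sense_stationary :: "(real \<Rightarrow> 'a \<Rightarrow> real) \<Rightarrow> bool" where
  "weak_sense_stationary X \<longleftrightarrow>
     (\<forall>t. random_variable borel (X t)) \<and>
     (\<exists>m. \<forall>t. expectation (X t) = m) \<and>
     (\<forall>t. integrable M (\<lambda>\<omega>. (X t \<omega>)\<^sup>2)) \<and>
     (\<exists>C :: real \<Rightarrow> real. \<forall>t s. covariance (X t) (X s) = C \<bar>t - s\<bar>)"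

end

end

theory Submission
  imports Defs
begin

text \<open>The density of \<open>BN(\<mu>,\<sigma>,\<alpha>)\<close> is the equal-weight mixture of the normal densities
  with means \<open>\<mu> \<plusminus> \<alpha>\<sigma>\<close> and standard deviation \<open>\<sigma>\<close>, so its mean is \<open>\<mu>\<close> and its variance
  \<open>\<sigma>\<^sup>2 (1 + \<alpha>\<^sup>2)\<close>. Weak-sense stationarity makes the mean and the variance constant in
  time, hence also \<open>\<mu>\<close> and, because \<open>\<sigma> > 0\<close>, \<open>\<sigma>\<close>.\<close>

lemma bn_density_eq_mixture:
  assumes "\<sigma> > 0"
  shows "bn_density \<mu> \<sigma> \<alpha> x =
    (normal_density (\<mu> + \<alpha> * \<sigma>) \<sigma> x + normal_density (\<mu> - \<alpha> * \<sigma>) \<sigma> x) / 2"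
proof -
  define z where "z = (x - \<mu>) / \<sigma>"
  \<comment> \<open>Completing the square: each normal exponent is the common Gaussian part plus one
    of the two exponents \<open>\<alpha> * z\<close>, \<open>- (\<alpha> * z)\<close> that make up
    \<open>cosh\<close>.\<close>
  have "- (x - (\<mu> + \<alpha> * \<sigma>))\<^sup>2 / (2 * \<sigma>\<^sup>2) = (- (1 / 2) * z\<^sup>2 - \<alpha>\<^sup>2 / 2) + \<alpha> * z"
    and "- (x - (\<mu> - \<alpha> * \<sigma>))\<^sup>2 / (2 * \<sigma>\<^sup>2) = (- (1 / 2) * z\<^sup>2 - \<alpha>\<^sup>2 / 2) + - (\<alpha> * z)"
    using assms by (simp_all add: z_def field_simps power2_eq_square)
  then show ?thesis
    unfolding bn_density_def normal_density_def z_def[symmetric] cosh_def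
    by (simp only: exp_add) (simp add: algebra_simps add_divide_distrib)
qed

text \<open>Expand about the mean, \<open>x - c = (x - m) + (m - c)\<close>, and integrate termwise.
  The centre \<open>c\<close> is free because the mixture components are not centred at the mean of
  the mixture unless \<open>\<alpha> = 0\<close>.\<close>

lemma normal_shifted_moments:
  assumes "\<sigma> > 0"
  shows "has_bochner_integral lborel (\<lambda>x. normal_density m \<sigma> x * (x - c)) (m - c)"
    and "has_bochner_integral lborel (\<lambda>x. normal_density m \<sigma> x * (x - c)\<^sup>2) (\<sigma>\<^sup>2 + (m - c)\<^sup>2)"
proof -
  \<comment> \<open>The last index \<open>k\<close> selects the central moment of order
    \<open>2 * k\<close> (even) or \<open>2 * k + 1\<close> (odd).\<close>
  have 0: "has_bochner_integral lborel (\<lambda>x. normal_density m \<sigma> x) 1"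
    using normal_moment_even[OF assms, of m 0] by simp
  have 1: "has_bochner_integral lborel (\<lambda>x. normal_density m \<sigma> x * (x - m)) 0"
    using normal_moment_odd[OF assms, of m 0] by simp
  have 2: "has_bochner_integral lborel (\<lambda>x. normal_density m \<sigma> x * (x - m)\<^sup>2) (\<sigma>\<^sup>2)"
    using normal_moment_even[OF assms, of m 1] by (simp add: fact_2)
  show "has_bochner_integral lborel (\<lambda>x. normal_density m \<sigma> x * (x - c)) (m - c)"
    using has_bochner_integral_add[OF 1 has_bochner_integral_mult_right[OF 0, of "m - c"]]
    by (simp add: algebra_simps)
  show "has_bochner_integral lborel (\<lambda>x. normal_density m \<sigma> x * (x - c)\<^sup>2) (\<sigma>\<^sup>2 + (m - c)\<^sup>2)"
    using has_bochner_integral_add[OF has_bochner_integral_add[OF 2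
        has_bochner_integral_mult_right[OF 1, of "2 * (m - c)"]]
        has_bochner_integral_mult_right[OF 0, of "(m - c)\<^sup>2"]]
    by (simp add: algebra_simps power2_eq_square)
qed

text \<open>Averaging the two components, the offsets \<open>\<alpha> * \<sigma>\<close> and
  \<open>- \<alpha> * \<sigma>\<close> cancel at first order, while their squares add
  \<open>\<alpha>\<^sup>2 * \<sigma>\<^sup>2\<close> to the variance.\<close>

lemma bn_moments:
  assumes "\<sigma> > 0"
  shows "has_bochner_integral lborel (\<lambda>x. bn_density \<mu> \<sigma> \<alpha> x * x) \<mu>"
    and "has_bochner_integral lborel (\<lambda>x. bn_density \<mu> \<sigma> \<alpha> x * (x - \<mu>)\<^sup>2) (\<sigma>\<^sup>2 * (1 + \<alpha>\<^sup>2))"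
proof -
  let ?p = "\<mu> + \<alpha> * \<sigma>" and ?q = "\<mu> - \<alpha> * \<sigma>"
  show "has_bochner_integral lborel (\<lambda>x. bn_density \<mu> \<sigma> \<alpha> x * x) \<mu>"
    using has_bochner_integral_mult_right[OF has_bochner_integral_add[OF
        normal_shifted_moments(1)[OF assms, of ?p 0]
        normal_shifted_moments(1)[OF assms, of ?q 0]], of "1 / 2"]
    by (simp add: bn_density_eq_mixture[OF assms] algebra_simps add_divide_distrib)
  show "has_bochner_integral lborel (\<lambda>x. bn_density \<mu> \<sigma> \<alpha> x * (x - \<mu>)\<^sup>2) (\<sigma>\<^sup>2 * (1 + \<alpha>\<^sup>2))"
    using has_bochner_integral_mult_right[OF has_bochner_integral_add[OF
        normal_shifted_moments(2)[OF assms, of ?p \<mu>]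
        normal_shifted_moments(2)[OF assms, of ?q \<mu>]], of "1 / 2"]
    by (simp add: bn_density_eq_mixture[OF assms] power_mult_distrib distrib_right distrib_left
        mult.commute add_divide_distrib)
qed

context prob_space
begin

lemma bn_distributed_moments:
  assumes "\<sigma> > 0"
    and X: "distributed M lborel X (\<lambda>x. ennreal (bn_density \<mu> \<sigma> \<alpha> x))"
  shows "expectation X = \<mu>"
    and "covariance X X = \<sigma>\<^sup>2 * (1 + \<alpha>\<^sup>2)"
proof -
  \<comment> \<open>\<open>ennreal\<close> sends negative reals to 0, so transferring integrals from
    \<open>M\<close> to \<open>lborel\<close> requires a nonnegative density.\<close>
  have nonneg: "0 \<le> bn_density \<mu> \<sigma> \<alpha> x" for x
    by (simp add: bn_density_eq_mixture[OF assms(1)])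
  show mean: "expectation X = \<mu>"
    using distributed_integral[OF X, of "\<lambda>x. x"] nonneg
      has_bochner_integral_integral_eq[OF bn_moments(1)[OF assms(1), of \<mu> \<alpha>]] by simp
  show "covariance X X = \<sigma>\<^sup>2 * (1 + \<alpha>\<^sup>2)"
    using distributed_integral[OF X, of "\<lambda>x. (x - \<mu>)\<^sup>2"] nonneg
      has_bochner_integral_integral_eq[OF bn_moments(2)[OF assms(1), of \<mu> \<alpha>]]
    by (simp add: covariance_def mean power2_eq_square)
qed

text \<open>The theorem follows by contraposition. Its hypothesis may fail to pin down which of
  \<open>\<mu>\<close> and \<open>\<sigma>\<close> varies, so both equalities are needed.\<close>

lemma bn_process_stationary_imp_constant:
  assumes bn: "bn_process X \<mu> \<sigma> \<alpha>" and wss: "weak_sense_stationary X"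
  shows "\<mu> t = \<mu> s" and "\<sigma> t = \<sigma> s"
proof -
  have pos: "\<sigma> u > 0"
    and D: "distributed M lborel (X u) (\<lambda>x. ennreal (bn_density (\<mu> u) (\<sigma> u) \<alpha> x))" for u
    using bn by (simp_all add: bn_process_def)
  show "\<mu> t = \<mu> s"
    using wss unfolding weak_sense_stationary_def bn_distributed_moments(1)[OF pos D] by metis
  obtain C where "covariance (X u) (X v) = C \<bar>u - v\<bar>" for u v
    using wss unfolding weak_sense_stationary_def by metis
  \<comment> \<open>Lag zero: the variance at every time is the same value
    \<open>C 0\<close>.\<close>
  then have "(\<sigma> u)\<^sup>2 * (1 + \<alpha>\<^sup>2) = C 0" for u
    using bn_distributed_moments(2)[OF pos D, of u] by simp
  then have "(\<sigma> t)\<^sup>2 * (1 + \<alpha>\<^sup>2) = (\<sigma> s)\<^sup>2 * (1 + \<alpha>\<^sup>2)"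
    by simp
  moreover have "1 + \<alpha>\<^sup>2 > 0"
    by (simp add: add_pos_nonneg)
  ultimately have "(\<sigma> t)\<^sup>2 = (\<sigma> s)\<^sup>2"
    by simp
  then show "\<sigma> t = \<sigma> s"
    using pos[of t] pos[of s] by (simp add: power2_eq_iff_nonneg)
qed

end

theorem proposition8p4:
  fixes M :: "'a measure"
    and X :: "real \<Rightarrow> 'a \<Rightarrow> real"
    and \<mu> \<sigma> :: "real \<Rightarrow> real"
    and \<alpha> :: real
  assumes "prob_space M"
    and "prob_space.bn_process M X \<mu> \<sigma> \<alpha>"
    and "\<not> ((\<exists>m. \<forall>t. \<mu> t = m) \<and> (\<exists>s. \<forall>t. \<sigma> t = s))"
  shows "\<not> prob_space.weak_sense_stationary M X"
  using prob_space.bn_process_stationary_imp_constant[OF assms(1,2)] assms(3) by metis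

end
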